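(* $I(\mathbb{H}_s)=\{0,1\}\cup\{\tfrac12+q_1\mathbf{i}+q_2\mathbf{j}+q_3\mathbf{k}: q_1,q_2,q_3\in\mathbb{R},\ \tfrac14+q_1^2-q_2^2-q_3^2=0\}$.
   Context: $\mathbb{H}_s=\{q_0+q_1\mathbf{i}+q_2\mathbf{j}+q_3\mathbf{k}: q_i\in\mathbb{R}\}$ is the real associative algebra of split quaternions with $\mathbf{i}^2=-1$, $\mathbf{j}^2=\mathbf{k}^2=1$, $\mathbf{i}\mathbf{j}=\mathbf{k}=-\mathbf{j}\mathbf{i}$, $\mathbf{j}\mathbf{k}=-\mathbf{i}=-\mathbf{k}\mathbf{j}$, $\mathbf{k}\mathbf{i}=\mathbf{j}=-\mathbf{i}\mathbf{k}$. $I(\mathbb{H}_s)=\{q\in\mathbb{H}_s:q^2=q\}$ is the set of idempotents. *)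

theory Defs
  imports Complex_Main
begin

datatype split_quat = SplitQuat (sq0: real) (sq1: real) (sq2: real) (sq3: real)

lemma split_quat_eq_iff:
  "p = q \<longleftrightarrow> sq0 p = sq0 q \<and> sq1 p = sq1 q \<and> sq2 p = sq2 q \<and> sq3 p = sq3 q"
  by (cases p; cases q) simp

instantiation split_quat :: real_algebra_1
begin

definition zero_split_quat :: split_quat where
  "0 = SplitQuat 0 0 0 0"

definition one_split_quat :: split_quat where
  "1 = SplitQuat 1 0 0 0"

definition plus_split_quat :: "split_quat \<Rightarrow> split_quat \<Rightarrow> split_quat" where
  "p + q = SplitQuat (sq0 p + sq0 q) (sq1 p + sq1 q) (sq2 p + sq2 q) (sq3 p + sq3 q)"

definition uminus_split_quat :: "split_quat \<Rightarrow> split_quat" where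
  "- p = SplitQuat (- sq0 p) (- sq1 p) (- sq2 p) (- sq3 p)"

definition minus_split_quat :: "split_quat \<Rightarrow> split_quat \<Rightarrow> split_quat" where
  "p - q = SplitQuat (sq0 p - sq0 q) (sq1 p - sq1 q) (sq2 p - sq2 q) (sq3 p - sq3 q)"

definition scaleR_split_quat :: "real \<Rightarrow> split_quat \<Rightarrow> split_quat" where
  "r *\<^sub>R q = SplitQuat (r * sq0 q) (r * sq1 q) (r * sq2 q) (r * sq3 q)"

text \<open>The bilinear extension of the multiplication table of the basis units, which is
  recovered in \<open>split_quat_units_mult\<close> below.\<close>

definition times_split_quat :: "split_quat \<Rightarrow> split_quat \<Rightarrow> split_quat" where
  "p * q = SplitQuat
     (sq0 p * sq0 q - sq1 p * sq1 q + sq2 p * sq2 q + sq3 p * sq3 q)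
     (sq0 p * sq1 q + sq1 p * sq0 q - sq2 p * sq3 q + sq3 p * sq2 q)
     (sq0 p * sq2 q + sq2 p * sq0 q + sq3 p * sq1 q - sq1 p * sq3 q)
     (sq0 p * sq3 q + sq3 p * sq0 q + sq1 p * sq2 q - sq2 p * sq1 q)"

instance
  by standard
    (simp_all add: split_quat_eq_iff zero_split_quat_def one_split_quat_def plus_split_quat_def
      uminus_split_quat_def minus_split_quat_def scaleR_split_quat_def times_split_quat_def
      algebra_simps)

end

definition sq_i :: split_quat where
  "sq_i = SplitQuat 0 1 0 0"

definition sq_j :: split_quat where
  "sq_j = SplitQuat 0 0 1 0"

definition sq_k :: split_quat where
  "sq_k = SplitQuat 0 0 0 1"

lemma split_quat_units_mult:
  "sq_i\<^sup>2 = -1" "sq_j\<^sup>2 = 1" "sq_k\<^sup>2 = 1"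
  "sq_i * sq_j = sq_k" "sq_j * sq_i = - sq_k"
  "sq_j * sq_k = - sq_i" "sq_k * sq_j = sq_i"
  "sq_k * sq_i = sq_j" "sq_i * sq_k = - sq_j"
  by (simp_all add: power2_eq_square sq_i_def sq_j_def sq_k_def one_split_quat_def
      uminus_split_quat_def times_split_quat_def)

lemma SplitQuat_eq:
  "SplitQuat a b c d = of_real a + b *\<^sub>R sq_i + c *\<^sub>R sq_j + d *\<^sub>R sq_k"
  by (simp add: of_real_def sq_i_def sq_j_def sq_k_def one_split_quat_def
      plus_split_quat_def scaleR_split_quat_def)

definition split_quat_idempotents :: "split_quat set" where
  "split_quat_idempotents = {q. q\<^sup>2 = q}"

end

theory Submission
  imports Defs
begin

text \<open>In \<open>q\<^sup>2\<close> the mixed products of imaginary units cancel by anticommutativity, so the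
  imaginary part of \<open>q\<^sup>2\<close> is \<open>2 * sq0 q\<close> times that of \<open>q\<close>. If \<open>q\<close> is idempotent, then
  either its imaginary part vanishes, and \<open>q\<close> is an idempotent of the field of real numbers, or
  \<open>sq0 q = 1 / 2\<close>, and only the equation of the real parts remains; at \<open>sq0 q = 1 / 2\<close> it is the
  stated quadric.\<close>

lemma split_quat_power2:
  "(SplitQuat a b c d)\<^sup>2 =
    SplitQuat (a\<^sup>2 - b\<^sup>2 + c\<^sup>2 + d\<^sup>2) (2 * a * b) (2 * a * c) (2 * a * d)"
  by (simp add: power2_eq_square times_split_quat_def)

lemma split_quat_idempotent_iff:
  "(SplitQuat a b c d)\<^sup>2 = SplitQuat a b c d \<longleftrightarrow>
    SplitQuat a b c d \<in> {0, 1} \<or> a = 1 / 2 \<and> 1 / 4 + b\<^sup>2 - c\<^sup>2 - d\<^sup>2 = 0"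
proof (cases "a = 1 / 2")
  case True
  \<comment> \<open>The real parts give \<open>1 / 4 - b\<^sup>2 + c\<^sup>2 + d\<^sup>2 = 1 / 2\<close>, which is the quadric with all signs
    reversed.\<close>
  show ?thesis
    unfolding True
    by (auto simp: split_quat_power2 zero_split_quat_def one_split_quat_def power_divide)
next
  case False
  then have scale: "2 * a * x = x \<longleftrightarrow> x = 0" for x
    by auto
  have "a\<^sup>2 = a \<longleftrightarrow> a = 0 \<or> a = 1"
    by (auto simp: power2_eq_square)
  with False show ?thesis
    by (auto simp: split_quat_power2 scale zero_split_quat_def one_split_quat_def)
qed

theorem proposition2p3:
  shows "split_quat_idempotents =
    {0, 1} \<union>
    {of_real (1 / 2) + q1 *\<^sub>R sq_i + q2 *\<^sub>R sq_j + q3 *\<^sub>R sq_k | q1 q2 q3 :: real.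
      1 / 4 + q1\<^sup>2 - q2\<^sup>2 - q3\<^sup>2 = 0}"
proof (rule set_eqI)
  fix q :: split_quat
  obtain a b c d where q: "q = SplitQuat a b c d"
    by (cases q)
  show "q \<in> split_quat_idempotents \<longleftrightarrow> q \<in> {0, 1} \<union>
    {of_real (1 / 2) + q1 *\<^sub>R sq_i + q2 *\<^sub>R sq_j + q3 *\<^sub>R sq_k | q1 q2 q3 :: real.
      1 / 4 + q1\<^sup>2 - q2\<^sup>2 - q3\<^sup>2 = 0}"
    unfolding q split_quat_idempotents_def SplitQuat_eq[symmetric] mem_Collect_eq Un_iff
      split_quat_idempotent_iff
    by simp
qed

end
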